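(* Let $X$ be a linear order that is connected in its interval topology, and let $d\ge1$. Then for every permutation $\alpha=(i_1\cdots i_d)$ of $\{1,\ldots,d\}$, the chamber $\mathcal{O}_\alpha=\{(x_1,\ldots,x_d)\in X^d: x_{i_1}<\cdots<x_{i_d}\}$ is a connected subset of $X^d$.
   Context: $X$ is a linearly ordered set with $|X|>2$, endowed with the interval (order) topology, whose base consists of the open rays $\{x:x<a\}$, $\{x:x>a\}$ and open intervals $\{x:a<x<b\}$; $X^d$ carries the product topology. *)

theory Defs
  imports "HOL-Analysis.Analysis" "HOL-Combinatorics.Permutations"
begin

text \<open>Points of \<open>X\<^sup>d\<close> are the extensional functions on \<open>{1..d}\<close>,
  i.e. the points of the product topology with index set \<open>{1..d}\<close>. A linear order
  carrying its interval topology is a type of class \<open>linorder_topology\<close>.\<close>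

definition power_topology :: "nat \<Rightarrow> (nat \<Rightarrow> 'a::topological_space) topology" where
  "power_topology d = product_topology (\<lambda>_. euclidean) {1..d}"

text \<open>The permutation \<open>(i\<^sub>1 \<dots> i\<^sub>d)\<close> in one-line notation is the function \<open>\<alpha>\<close>
  with \<open>\<alpha> k = i\<^sub>k\<close>.\<close>

definition chamber :: "nat \<Rightarrow> (nat \<Rightarrow> nat) \<Rightarrow> (nat \<Rightarrow> 'a::linorder) set" where
  "chamber d \<alpha> = {x \<in> {1..d} \<rightarrow>\<^sub>E UNIV. \<forall>k\<in>{1..<d}. x (\<alpha> k) < x (\<alpha> (Suc k))}"

end

theory Submission
  imports Defs
begin

text \<open>The chamber is closed under coordinatewise minima, so it suffices to connect a point \<open>x\<close>
  to a point \<open>z \<le> x\<close> of the same chamber. Lower the coordinates from \<open>x\<close> to \<open>z\<close> one at a time,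
  smallest coordinate first: the chamber inequalities persist throughout, and each move runs over
  a closed interval of \<open>X\<close>, which is connected because it is a retract of \<open>X\<close>.\<close>

lemma connected_atLeastAtMost_if_connected_UNIV:
  fixes a b :: "'a::linorder_topology"
  assumes "connected (UNIV :: 'a set)"
  shows "connected {a..b}"
proof (cases "a \<le> b")
  case True
  \<comment> \<open>The retraction is clamping: \<open>max\<close> and \<open>min\<close> are
    continuous in an order topology, and for \<open>a \<le> b\<close> the values stay in
    \<open>{a..b}\<close>, whose points are fixed.\<close>
  have "continuous_on UNIV (\<lambda>t. max a (min b t))"
    by (intro continuous_intros)
  then have "connected (range (\<lambda>t. max a (min b t)))"
    using assms connected_continuous_image by blast
  moreover have "range (\<lambda>t. max a (min b t)) = {a..b}"
  proof
    show "range (\<lambda>t. max a (min b t)) \<subseteq> {a..b}"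
      using True by auto
    show "{a..b} \<subseteq> range (\<lambda>t. max a (min b t))"
    proof
      fix t assume "t \<in> {a..b}"
      then have "t = max a (min b t)" by auto
      then show "t \<in> range (\<lambda>t. max a (min b t))" by blast
    qed
  qed
  ultimately show ?thesis by simp
qed simp

lemma continuous_map_power_topology_fun_upd:
  assumes "x \<in> topspace (power_topology d)" "j \<in> {1..d}"
  shows "continuous_map euclidean (power_topology d) (\<lambda>t. x(j := t))"
  using assms unfolding power_topology_def continuous_map_componentwise
  by (auto simp: PiE_iff extensional_def)

text \<open>The segment traced by \<open>t\<close> from \<open>b\<close> to \<open>x j\<close> is a
  continuous image of an interval, hence a connected set; by assumption it stays inside
  \<open>S\<close>, and it contains both points.\<close>

lemma connected_component_of_fun_upd:
  fixes x :: "nat \<Rightarrow> 'a::linorder_topology"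
  assumes conn: "connected (UNIV :: 'a set)"
    and x: "x \<in> topspace (power_topology d)" and j: "j \<in> {1..d}"
    and "b \<le> x j" and S: "\<And>t. b \<le> t \<Longrightarrow> t \<le> x j \<Longrightarrow> x(j := t) \<in> S"
  shows "connected_component_of (subtopology (power_topology d) S) x (x(j := b))"
proof -
  let ?T = "(\<lambda>t. x(j := t)) ` {b..x j}"
  have "connectedin euclidean {b..x j}"
    using connected_atLeastAtMost_if_connected_UNIV[OF conn] by simp
  then have "connectedin (power_topology d) ?T"
    using connectedin_continuous_map_image continuous_map_power_topology_fun_upd[OF x j] by blast
  moreover have "?T \<subseteq> S"
    using S by auto
  ultimately have "connectedin (subtopology (power_topology d) S) ?T"
    by (simp add: connectedin_subtopology)
  moreover have "x \<in> ?T"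
    using \<open>b \<le> x j\<close> by (intro image_eqI[of _ _ "x j"]) auto
  moreover have "x(j := b) \<in> ?T"
    using \<open>b \<le> x j\<close> by auto
  ultimately show ?thesis
    unfolding connected_component_of_def by blast
qed

lemma chamber_subset_topspace: "chamber d \<alpha> \<subseteq> topspace (power_topology d)"
  by (auto simp: chamber_def power_topology_def)

lemma connected_component_of_chamber_le:
  fixes x z :: "nat \<Rightarrow> 'a::linorder_topology"
  assumes conn: "connected (UNIV :: 'a set)" and \<alpha>: "\<alpha> permutes {1..d}"
    and x: "x \<in> chamber d \<alpha>" and z: "z \<in> chamber d \<alpha>"
    and le: "\<And>i. i \<in> {1..d} \<Longrightarrow> z i \<le> x i"
  shows "connected_component_of (subtopology (power_topology d) (chamber d \<alpha>)) x z"
proof -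
  \<comment> \<open>Stage \<open>k\<close> of the descent: \<open>inv \<alpha> i\<close> is the
    position of coordinate \<open>i\<close> in the chamber order, and the coordinates in positions
    up to \<open>k\<close> have been lowered.\<close>
  define w where "w k i = (if inv \<alpha> i \<le> k then z i else x i)" for k i
  have inv_\<alpha> [simp]: "inv \<alpha> (\<alpha> m) = m" for m
    using permutes_inverses(2)[OF \<alpha>] .
  have \<alpha>_inv: "\<alpha> (inv \<alpha> i) = i" for i
    using permutes_inverses(1)[OF \<alpha>] .
  have \<alpha>_eq [simp]: "\<alpha> m = \<alpha> n \<longleftrightarrow> m = n" for m n
    using inj_eq[OF permutes_inj[OF \<alpha>]] .
  have \<alpha>_in: "\<alpha> m \<in> {1..d} \<longleftrightarrow> m \<in> {1..d}" for m
    using permutes_in_image[OF \<alpha>] .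
  have inv_in: "inv \<alpha> i \<in> {1..d} \<longleftrightarrow> i \<in> {1..d}" for i
    using permutes_in_image[OF permutes_inv[OF \<alpha>]] .
  have ext: "x i = undefined" "z i = undefined" if "i \<notin> {1..d}" for i
    using x z that unfolding chamber_def by (auto simp: PiE_iff extensional_def)
  have x_less: "x (\<alpha> m) < x (\<alpha> (Suc m))" and z_less: "z (\<alpha> m) < z (\<alpha> (Suc m))"
    if "m \<in> {1..<d}" for m
    using x z that unfolding chamber_def by auto
  have moved: "(w k)(\<alpha> (Suc k) := t) \<in> chamber d \<alpha>"
    if k: "Suc k \<le> d" and t: "z (\<alpha> (Suc k)) \<le> t" "t \<le> x (\<alpha> (Suc k))" for k t
  proof -
    let ?u = "(w k)(\<alpha> (Suc k) := t)"
    have "?u i = undefined" if "i \<notin> {1..d}" for i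
      using that k ext[OF that] \<alpha>_in[of "Suc k"] by (auto simp: w_def)
    moreover have "?u (\<alpha> m) < ?u (\<alpha> (Suc m))" if m: "m \<in> {1..<d}" for m
    proof -
      \<comment> \<open>Away from the moving coordinate both sides come from \<open>z\<close> or
        both from \<open>x\<close>. At \<open>m = k\<close> the left neighbour is already lowered,
        so \<open>z (\<alpha> k) < z (\<alpha> (Suc k)) \<le> t\<close>; at \<open>m = Suc k\<close>
        the right neighbour is still at its \<open>x\<close> value, which exceeds
        \<open>t\<close>.\<close>
      consider "Suc m \<le> k" | "m = k" | "m = Suc k" | "Suc k < m" by linarith
      then show ?thesis
        using x_less[OF m] z_less[OF m] t by cases (auto simp: w_def)
    qed
    ultimately show ?thesis
      unfolding chamber_def by (auto simp: PiE_iff extensional_def)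
  qed
  have "connected_component_of (subtopology (power_topology d) (chamber d \<alpha>)) x (w k)"
    if "k \<le> d" for k
    using that
  proof (induction k)
    case 0
    \<comment> \<open>Positions of genuine coordinates start at 1, so none is lowered yet. The index
      0 does satisfy \<open>inv \<alpha> 0 \<le> 0\<close>, but there \<open>x\<close> and
      \<open>z\<close> are both \<open>undefined\<close>.\<close>
    have "w 0 i = x i" for i
      using ext[of i] inv_in[of i] by (cases "i \<in> {1..d}") (auto simp: w_def)
    then have "w 0 = x" by blast
    then show ?case
      using x chamber_subset_topspace
      by (auto simp: connected_component_of_refl topspace_subtopology)
  next
    case (Suc k)
    let ?j = "\<alpha> (Suc k)"
    have j: "?j \<in> {1..d}"
      using Suc.prems by (simp only: \<alpha>_in) simp
    have wj: "w k ?j = x ?j"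
      by (simp add: w_def)
    \<comment> \<open>The start of the move is its instance \<open>t = x ?j\<close>, where the
      update changes nothing.\<close>
    have "w k \<in> chamber d \<alpha>"
      using moved[OF Suc.prems, of "x ?j"] le[OF j] fun_upd_triv[of "w k" ?j] wj by simp
    then have top: "w k \<in> topspace (power_topology d)"
      using chamber_subset_topspace by blast
    have "inv \<alpha> i = Suc k \<longleftrightarrow> i = ?j" for i
      using \<alpha>_inv[of i] by auto
    then have upd: "w (Suc k) = (w k)(?j := z ?j)"
      by (auto simp: w_def le_Suc_eq)
    have "connected_component_of (subtopology (power_topology d) (chamber d \<alpha>))
        (w k) ((w k)(?j := z ?j))"
      by (rule connected_component_of_fun_upd[OF conn top j])
        (use wj le[OF j] moved[OF Suc.prems] in auto)
    then show ?case
      using Suc connected_component_of_trans unfolding upd by fastforce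
  qed
  moreover have "w d = z"
  proof
    fix i show "w d i = z i"
      using ext[of i] inv_in[of i] by (cases "i \<in> {1..d}") (auto simp: w_def)
  qed
  ultimately show ?thesis by force
qed

text \<open>The smaller of the two left entries lies below each right entry, hence below their
  minimum; \<open>restrict\<close> keeps the point extensional.\<close>

lemma chamber_min:
  assumes \<alpha>: "\<alpha> permutes {1..d}" and x: "x \<in> chamber d \<alpha>" and y: "y \<in> chamber d \<alpha>"
  shows "restrict (\<lambda>i. min (x i) (y i)) {1..d} \<in> chamber d \<alpha>"
proof -
  have "\<alpha> m \<in> {1..d}" "\<alpha> (Suc m) \<in> {1..d}" if "m \<in> {1..<d}" for m
    using that permutes_in_image[OF \<alpha>, of m] permutes_in_image[OF \<alpha>, of "Suc m"] by auto
  moreover have "min (x (\<alpha> m)) (y (\<alpha> m)) < min (x (\<alpha> (Suc m))) (y (\<alpha> (Suc m)))"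
    if "m \<in> {1..<d}" for m
    using x y that unfolding chamber_def by (auto simp: min_less_iff_disj)
  ultimately show ?thesis
    unfolding chamber_def by auto
qed

theorem theorem10:
  fixes d :: nat and \<alpha> :: "nat \<Rightarrow> nat"
  assumes "\<exists>a b c :: 'a::linorder_topology. a \<noteq> b \<and> a \<noteq> c \<and> b \<noteq> c"
    and "connected (UNIV :: 'a set)"
    and "d \<ge> 1"
    and "\<alpha> permutes {1..d}"
  shows "connectedin (power_topology d) (chamber d \<alpha> :: (nat \<Rightarrow> 'a) set)"
proof -
  let ?S = "subtopology (power_topology d) (chamber d \<alpha> :: (nat \<Rightarrow> 'a) set)"
  have "connected_component_of ?S x y" if x: "x \<in> chamber d \<alpha>" and y: "y \<in> chamber d \<alpha>" for x y
  proof -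
    let ?z = "restrict (\<lambda>i. min (x i) (y i)) {1..d}"
    \<comment> \<open>Since \<open>x\<close> and \<open>y\<close> may be incomparable
      coordinatewise, both descend to a common lower point, and the two descents are glued by
      symmetry and transitivity.\<close>
    have "connected_component_of ?S x ?z" "connected_component_of ?S y ?z"
      using connected_component_of_chamber_le[OF assms(2,4) _ chamber_min[OF assms(4) x y]] x y by auto
    then show ?thesis
      by (meson connected_component_of_sym connected_component_of_trans)
  qed
  then have "connected_space ?S"
    by (simp add: connected_space_iff_connected_component)
  then show ?thesis
    by (simp add: connectedin_def chamber_subset_topspace)
qed

end
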